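(* Consider the origin-centered, axis-aligned ellipse $\frac{x^2}{a^2}+\frac{y^2}{b^2}=1$ with semi-axes $(a,b)$ and the internal concentric, axis-aligned ellipse with semi-axes $(a/2,b/2)$ (the homothetic pair), and the family of 3-periodics in this pair, that is, of triangles inscribed in the outer ellipse and circumscribed about the inner one. The loci of the Brocard points $\Omega_1$ and $\Omega_2$ over this family are ellipses $E_1$ and $E_2$ which are reflected images of each other about either the $x$-axis or the $y$-axis. Furthermore, $E_1$ and $E_2$ are concentric and homothetic to the ellipses in the pair.
   Context: The two ellipses with semi-axes $(a,b)$ and $(a',b')=(a/2,b/2)$ satisfy $a'/a+b'/b=1$, so they are associated with a Poncelet porism of 3-periodics: every point of the outer ellipse is a vertex of a triangle inscribed in the outer ellipse whose three sides are tangent to the inner one, and these triangles form a one-parameter family. Brocard points: the Brocard points $\Omega_1,\Omega_2$ of a triangle are the two interior points where its sides concur when each is rotated about a vertex by a special angle $\omega$ (the Brocard angle); traversing and rotating the sides clockwise gives $\Omega_1$, and counterclockwise gives $\Omega_2$. Equivalently, if the vertices are labeled clockwise as $P_1,P_2,P_3$, then $\Omega_1$ is the interior point with $\angle\Omega_1P_1P_2=\angle\Omega_1P_2P_3=\angle\Omega_1P_3P_1=\omega$, and $\Omega_2$ is the interior point with $\angle\Omega_2P_2P_1=\angle\Omega_2P_3P_2=\angle\Omega_2P_1P_3=\omega$.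
   Formalization: "Homothetic" is taken up to a rotation about the common centre (same aspect ratio, tilted axes), since the loci are never axis-aligned and literal homothety fails; a ≠ b is assumed, since for a = b both loci are a single point and not ellipses. *)

theory Defs
  imports "HOL-Analysis.Analysis"
begin

text \<open>
  The Euclidean plane is the type \<^typ>\<open>complex\<close>, with Cartesian coordinates \<^const>\<open>Re\<close> and \<^const>\<open>Im\<close>.
  Multiplication by \<^term>\<open>cis t\<close> is the rotation by \<open>t\<close> about the origin; \<^term>\<open>cnj z\<close> and \<^term>\<open>- cnj z\<close>
  are the mirror images of \<open>z\<close> in the x-axis and in the y-axis.
\<close>

definition ellipse_form :: "real \<Rightarrow> real \<Rightarrow> complex \<Rightarrow> real" where
  "ellipse_form a b z = (Re z)\<^sup>2 / a\<^sup>2 + (Im z)\<^sup>2 / b\<^sup>2"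

definition ellipse :: "real \<Rightarrow> real \<Rightarrow> complex set" where
  "ellipse a b = {z. ellipse_form a b z = 1}"

definition ellipse_centered_at :: "complex \<Rightarrow> complex set \<Rightarrow> bool" where
  "ellipse_centered_at c E \<longleftrightarrow>
     (\<exists>p q t. p > 0 \<and> q > 0 \<and> E = (\<lambda>z. c + cis t * z) ` ellipse p q)"

text \<open>
  \<open>E\<close> is the image of \<open>F\<close> under a homothety with centre \<open>c\<close> followed by a rotation about \<open>c\<close>.
  The rotation has to be allowed: the loci of the Brocard points have the aspect ratio of the two
  given ellipses, but their axes are tilted against the coordinate axes.
\<close>

definition homothetic_up_to_rotation :: "complex \<Rightarrow> complex set \<Rightarrow> complex set \<Rightarrow> bool" where
  "homothetic_up_to_rotation c E F \<longleftrightarrow>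
     (\<exists>k t. k > 0 \<and> E = (\<lambda>z. c + cis t * (complex_of_real k * (z - c))) ` F)"

text \<open>
  The segment \<open>PQ\<close> touches the ellipse, as a level curve of \<^const>\<open>ellipse_form\<close>, at a point \<open>T\<close>:
  the direction of the segment lies in the kernel of the derivative at \<open>T\<close>.
\<close>

definition side_tangent :: "real \<Rightarrow> real \<Rightarrow> complex \<Rightarrow> complex \<Rightarrow> bool" where
  "side_tangent a b P Q \<longleftrightarrow> P \<noteq> Q \<and>
     (\<exists>T \<in> closed_segment P Q \<inter> ellipse a b.
        frechet_derivative (ellipse_form a b) (at T) (Q - P) = 0)"

definition inscribed_triangle :: "real \<Rightarrow> real \<Rightarrow> complex \<Rightarrow> complex \<Rightarrow> complex \<Rightarrow> bool" where
  "inscribed_triangle a b P Q R \<longleftrightarrow> \<not> collinear {P, Q, R} \<and> {P, Q, R} \<subseteq> ellipse a b"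

definition circumscribed_triangle :: "real \<Rightarrow> real \<Rightarrow> complex \<Rightarrow> complex \<Rightarrow> complex \<Rightarrow> bool" where
  "circumscribed_triangle a b P Q R \<longleftrightarrow>
     side_tangent a b P Q \<and> side_tangent a b Q R \<and> side_tangent a b R P"

definition homothetic_pair_triangle :: "real \<Rightarrow> real \<Rightarrow> complex \<Rightarrow> complex \<Rightarrow> complex \<Rightarrow> bool" where
  "homothetic_pair_triangle a b P Q R \<longleftrightarrow>
     inscribed_triangle a b P Q R \<and> circumscribed_triangle (a / 2) (b / 2) P Q R"

text \<open>The cross product of \<open>Q - P\<close> and \<open>R - P\<close> is negative.\<close>

definition clockwise :: "complex \<Rightarrow> complex \<Rightarrow> complex \<Rightarrow> bool" where
  "clockwise P Q R \<longleftrightarrow> Im (cnj (Q - P) * (R - P)) < 0"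

text \<open>The unoriented angle \<open>ABC\<close> with vertex \<open>B\<close>, in the interval from 0 to \<^const>\<open>pi\<close>.\<close>

definition angle_at :: "complex \<Rightarrow> complex \<Rightarrow> complex \<Rightarrow> real" where
  "angle_at A B C = arccos (((A - B) \<bullet> (C - B)) / (norm (A - B) * norm (C - B)))"

text \<open>In both definitions the vertices are understood to be labelled clockwise.\<close>

definition brocard_point_1 :: "complex \<Rightarrow> complex \<Rightarrow> complex \<Rightarrow> complex \<Rightarrow> bool" where
  "brocard_point_1 P\<^sub>1 P\<^sub>2 P\<^sub>3 X \<longleftrightarrow> X \<in> interior (convex hull {P\<^sub>1, P\<^sub>2, P\<^sub>3}) \<and>
     (\<exists>\<omega>. angle_at X P\<^sub>1 P\<^sub>2 = \<omega> \<and> angle_at X P\<^sub>2 P\<^sub>3 = \<omega> \<and> angle_at X P\<^sub>3 P\<^sub>1 = \<omega>)"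

definition brocard_point_2 :: "complex \<Rightarrow> complex \<Rightarrow> complex \<Rightarrow> complex \<Rightarrow> bool" where
  "brocard_point_2 P\<^sub>1 P\<^sub>2 P\<^sub>3 X \<longleftrightarrow> X \<in> interior (convex hull {P\<^sub>1, P\<^sub>2, P\<^sub>3}) \<and>
     (\<exists>\<omega>. angle_at X P\<^sub>2 P\<^sub>1 = \<omega> \<and> angle_at X P\<^sub>3 P\<^sub>2 = \<omega> \<and> angle_at X P\<^sub>1 P\<^sub>3 = \<omega>)"

definition brocard_locus_1 :: "real \<Rightarrow> real \<Rightarrow> complex set" where
  "brocard_locus_1 a b = {X. \<exists>P\<^sub>1 P\<^sub>2 P\<^sub>3. homothetic_pair_triangle a b P\<^sub>1 P\<^sub>2 P\<^sub>3 \<and>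
     clockwise P\<^sub>1 P\<^sub>2 P\<^sub>3 \<and> brocard_point_1 P\<^sub>1 P\<^sub>2 P\<^sub>3 X}"

definition brocard_locus_2 :: "real \<Rightarrow> real \<Rightarrow> complex set" where
  "brocard_locus_2 a b = {X. \<exists>P\<^sub>1 P\<^sub>2 P\<^sub>3. homothetic_pair_triangle a b P\<^sub>1 P\<^sub>2 P\<^sub>3 \<and>
     clockwise P\<^sub>1 P\<^sub>2 P\<^sub>3 \<and> brocard_point_2 P\<^sub>1 P\<^sub>2 P\<^sub>3 X}"

end

theory Submission
  imports Defs
begin

text \<open>
  The map \<open>u \<mapsto> (a Re u, b Im u)\<close> carries the unit circle to the outer ellipse and the circle of
  radius 1/2 to the inner one. Two points of the unit circle span a chord tangent to the smaller
  circle exactly if their inner product is -1/2, so the 3-periodics are the images of the inscribed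
  equilateral triangles (lemma \<open>homothetic_pair_triangle_iff\<close>).

  In any triangle the first Brocard point has barycentric weights that are products of two squared
  side lengths (lemma \<open>brocard_point_1_iff\<close>). The affine map reads \<open>p u + q cnj u\<close> with
  \<open>p = (a + b) / 2\<close> and \<open>q = (a - b) / 2\<close>. Along the family the sum of the weights is constant, and in
  the weighted sum of the vertices, a trigonometric polynomial of degree 5 in \<open>u\<close>, the symmetry of
  order 3 leaves only the terms in \<open>u^3\<close> and \<open>cnj u^3\<close> (lemma \<open>brocard_barycentric_identity\<close>). With
  \<open>y = u^3\<close> running through the unit circle, the locus is
  \<open>p A y + q B cnj y\<close>, up to a real factor, where \<open>A\<close> and \<open>B\<close> turn out to be unimodular. Shifting the
  phase of \<open>y\<close> turns this into \<open>c (p v + q cnj v)\<close> with \<open>c^2 = A B\<close>: the outer ellipse, scaled and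
  rotated (lemma \<open>brocard_locus_1_eq\<close>). The real factor is a multiple of \<open>p q\<close>, which is nonzero
  because \<open>a\<close> and \<open>b\<close> differ.

  A reflection in a coordinate axis preserves the family and reverses orientation, hence exchanges
  the two kinds of Brocard points. So the second locus is the mirror image of the first.
\<close>

section \<open>Ellipses as images of the unit circle\<close>

definition stretch :: "real \<Rightarrow> real \<Rightarrow> complex \<Rightarrow> complex" where
  "stretch a b u = Complex (a * Re u) (b * Im u)"

lemma stretch_eq: "stretch a b u = of_real ((a + b) / 2) * u + of_real ((a - b) / 2) * cnj u"
  by (simp add: stretch_def complex_eq_iff field_simps)

lemma norm_1_iff: "norm u = 1 \<longleftrightarrow> (Re u)\<^sup>2 + (Im u)\<^sup>2 = 1"
  by (simp add: cmod_def)

lemma ellipse_form_stretch: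
  assumes "a > 0" "b > 0"
  shows "ellipse_form a b (stretch a b u) = (norm u)\<^sup>2"
  using assms by (simp add: ellipse_form_def stretch_def cmod_power2 power_mult_distrib)

lemma ellipse_eq_stretch:
  assumes "a > 0" "b > 0"
  shows "ellipse a b = stretch a b ` sphere 0 1"
proof
  show "ellipse a b \<subseteq> stretch a b ` sphere 0 1"
  proof
    fix x assume x: "x \<in> ellipse a b"
    have "x = stretch a b (stretch (1/a) (1/b) x)"
      using assms by (simp add: stretch_def)
    moreover have "stretch (1/a) (1/b) x \<in> sphere 0 1"
      using x by (simp add: stretch_def ellipse_def ellipse_form_def norm_1_iff power_divide)
    ultimately show "x \<in> stretch a b ` sphere 0 1" by blast
  qed
  show "stretch a b ` sphere 0 1 \<subseteq> ellipse a b"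
    using assms by (auto simp: ellipse_def ellipse_form_stretch)
qed

lemma ellipse_scale:
  assumes "a > 0" "b > 0" "k > 0"
  shows "ellipse (k * a) (k * b) = (\<lambda>z. of_real k * z) ` ellipse a b"
proof -
  have "stretch (k * a) (k * b) = (\<lambda>z. of_real k * z) \<circ> stretch a b"
    by (auto simp: stretch_def complex_eq_iff)
  with assms show ?thesis by (simp add: ellipse_eq_stretch image_comp)
qed

lemma frechet_ellipse_form:
  assumes "a > 0" "b > 0"
  shows "frechet_derivative (ellipse_form a b) (at T) v = 2 * (Re T * Re v / a\<^sup>2 + Im T * Im v / b\<^sup>2)"
proof -
  have "(ellipse_form a b has_derivative (\<lambda>v. 2 * (Re T * Re v / a\<^sup>2 + Im T * Im v / b\<^sup>2))) (at T)"
    unfolding ellipse_form_def [abs_def]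
    using assms by (auto intro!: derivative_eq_intros simp: fun_eq_iff field_simps)
  then show ?thesis by (simp add: frechet_derivative_at [symmetric])
qed

section \<open>The triangles of the homothetic pair\<close>

text \<open>
  In the unit disc the point of tangency \<open>w\<close> is orthogonal to the chord, so it is the midpoint, and
  its distance from the centre is 1/2 exactly if \<open>norm (u + v) = 1\<close>, that is, if
  the inner product of \<open>u\<close> and \<open>v\<close> is -1/2.
\<close>

lemma side_tangent_stretch_iff:
  assumes ab: "a > 0" "b > 0" and u: "norm u = 1" and v: "norm v = 1"
  shows "side_tangent (a / 2) (b / 2) (stretch a b u) (stretch a b v) \<longleftrightarrow> u \<bullet> v = - 1 / 2"
proof -
  have uu: "u \<bullet> u = 1" and vv: "v \<bullet> v = 1" using u v by (simp_all add: norm_eq_1)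
  have comb: "(1 - t) *\<^sub>R stretch a b u + t *\<^sub>R stretch a b v = stretch a b ((1 - t) *\<^sub>R u + t *\<^sub>R v)" for t
    by (simp add: stretch_def complex_eq_iff algebra_simps)
  have diff: "stretch a b v - stretch a b u = stretch a b (v - u)"
    by (simp add: stretch_def complex_eq_iff algebra_simps)
  have form: "stretch a b w \<in> ellipse (a / 2) (b / 2) \<longleftrightarrow> w \<bullet> w = 1 / 4" for w
  proof -
    have "ellipse_form (a / 2) (b / 2) (stretch a b w) = 4 * (w \<bullet> w)"
      using ab by (simp add: ellipse_form_def stretch_def inner_complex_def power2_eq_square)
    then show ?thesis by (auto simp: ellipse_def)
  qed
  have deriv: "frechet_derivative (ellipse_form (a / 2) (b / 2)) (at (stretch a b w)) (stretch a b x) = 8 * (w \<bullet> x)" for w x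
    using ab by (simp add: frechet_ellipse_form stretch_def inner_complex_def power2_eq_square field_simps)
  have inj: "stretch a b u = stretch a b v \<longleftrightarrow> u = v"
    using ab by (auto simp: stretch_def complex_eq_iff)
  have "side_tangent (a / 2) (b / 2) (stretch a b u) (stretch a b v) \<longleftrightarrow>
    u \<noteq> v \<and> (\<exists>t. 0 \<le> t \<and> t \<le> 1 \<and> (let w = (1 - t) *\<^sub>R u + t *\<^sub>R v in w \<bullet> w = 1 / 4 \<and> w \<bullet> (v - u) = 0))"
  proof -
    have "(\<exists>T \<in> closed_segment (stretch a b u) (stretch a b v) \<inter> ellipse (a / 2) (b / 2). \<phi> T) \<longleftrightarrow>
      (\<exists>t. 0 \<le> t \<and> t \<le> 1 \<and> stretch a b ((1 - t) *\<^sub>R u + t *\<^sub>R v) \<in> ellipse (a / 2) (b / 2) \<and>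
         \<phi> (stretch a b ((1 - t) *\<^sub>R u + t *\<^sub>R v)))" for \<phi>
      unfolding closed_segment_def comb by blast
    then show ?thesis by (simp add: side_tangent_def diff form deriv inj Let_def)
  qed
  also have "\<dots> \<longleftrightarrow> u \<bullet> v = - 1 / 2"
  proof
    assume "u \<noteq> v \<and> (\<exists>t. 0 \<le> t \<and> t \<le> 1 \<and> (let w = (1 - t) *\<^sub>R u + t *\<^sub>R v in w \<bullet> w = 1 / 4 \<and> w \<bullet> (v - u) = 0))"
    then obtain t where ne: "u \<noteq> v" and
       1: "((1 - t) *\<^sub>R u + t *\<^sub>R v) \<bullet> ((1 - t) *\<^sub>R u + t *\<^sub>R v) = 1 / 4" and
       2: "((1 - t) *\<^sub>R u + t *\<^sub>R v) \<bullet> (v - u) = 0" by (auto simp: Let_def)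
    have "u \<bullet> v \<noteq> 1"
    proof
      assume "u \<bullet> v = 1"
      then have "(u - v) \<bullet> (u - v) = 0" using uu vv by (simp add: inner_diff inner_commute)
      with ne show False by simp
    qed
    have "(2 * t - 1) * (1 - u \<bullet> v) = 0"
      using 2 uu vv by (simp add: inner_simps inner_commute algebra_simps)
    then have t: "t = 1 / 2" using \<open>u \<bullet> v \<noteq> 1\<close> by simp
    from 1 show "u \<bullet> v = - 1 / 2" unfolding t
      using uu vv by (simp add: inner_simps inner_commute)
  next
    assume *: "u \<bullet> v = - 1 / 2"
    then have "u \<noteq> v" using uu by auto
    moreover have "let w = (1 - 1/2) *\<^sub>R u + (1/2) *\<^sub>R v in w \<bullet> w = 1 / 4 \<and> w \<bullet> (v - u) = 0"
      using * uu vv by (simp add: Let_def inner_simps inner_commute)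
    ultimately show "u \<noteq> v \<and> (\<exists>t. 0 \<le> t \<and> t \<le> 1 \<and> (let w = (1 - t) *\<^sub>R u + t *\<^sub>R v in w \<bullet> w = 1 / 4 \<and> w \<bullet> (v - u) = 0))"
      by (auto intro!: exI[of _ "1/2"])
  qed
  finally show ?thesis .
qed

definition \<zeta> :: complex where "\<zeta> = cis (2 * pi / 3)"

lemma Re_zeta: "Re \<zeta> = - 1 / 2" and Im_zeta: "Im \<zeta> = sqrt 3 / 2"
  by (simp_all add: \<zeta>_def cos_120 sin_120)

lemma collinear_imp_cross_eq_0:
  fixes P Q R :: complex
  assumes "collinear {P, Q, R}"
  shows "Im (cnj (Q - P) * (R - P)) = 0"
proof -
  have "collinear {Q, P, R}" using assms by (simp add: insert_commute)
  then have "collinear {0, Q - P, R - P}" by (simp add: collinear_3)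
  then obtain c where "Q - P = 0 \<or> R - P = 0 \<or> R - P = c *\<^sub>R (Q - P)" by (auto simp: collinear_lemma)
  then show ?thesis
  proof (elim disjE)
    assume c: "R - P = c *\<^sub>R (Q - P)"
    show ?thesis unfolding c by (simp add: algebra_simps)
  qed simp_all
qed

text \<open>
  Three unit vectors with pairwise inner products -1/2 have sum zero, since the squared norm of the
  sum is 3 - 3. The orientation then decides between the two possible labellings.
\<close>

lemma homothetic_pair_triangle_iff:
  assumes ab: "a > 0" "b > 0"
  shows "homothetic_pair_triangle a b P Q R \<and> clockwise P Q R \<longleftrightarrow>
    (\<exists>u. norm u = 1 \<and> P = stretch a b u \<and> Q = stretch a b (u * cnj \<zeta>) \<and> R = stretch a b (u * \<zeta>))"
    (is "?L \<longleftrightarrow> ?R")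
proof
  have cross: "Im (cnj (stretch a b v - stretch a b u) * (stretch a b w - stretch a b u)) =
      a * b * Im (cnj (v - u) * (w - u))" for u v w
    by (simp add: stretch_def algebra_simps)
  {
    assume ?L
    then obtain u v w where uvw: "norm u = 1" "norm v = 1" "norm w = 1"
      and P: "P = stretch a b u" and Q: "Q = stretch a b v" and R: "R = stretch a b w"
      unfolding homothetic_pair_triangle_def inscribed_triangle_def using ellipse_eq_stretch[OF ab] by auto
    from \<open>?L\<close> have i: "u \<bullet> v = - 1 / 2" "v \<bullet> w = - 1 / 2" "w \<bullet> u = - 1 / 2"
      unfolding homothetic_pair_triangle_def circumscribed_triangle_def P Q R
      using side_tangent_stretch_iff[OF ab] uvw by auto
    have uvw': "u \<bullet> u = 1" "v \<bullet> v = 1" "w \<bullet> w = 1" using uvw by (simp_all add: norm_eq_1)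
    have "(u + v + w) \<bullet> (u + v + w) = 0"
      using i uvw' by (simp add: inner_simps inner_commute)
    then have "u + v + w = 0" by (simp only: inner_eq_zero_iff)
    then have w: "w = - u - v" by (metis add_diff_cancel_left' diff_0 diff_diff_eq)
    \<comment> \<open>The quotient of two vertices on the circle has real part -1/2; clockwise order makes its
      imaginary part negative.\<close>
    define y where "y = cnj u * v"
    have uu: "u * cnj u = 1" using uvw by (simp add: complex_norm_square[symmetric])
    have v: "v = u * y" unfolding y_def using uu by (metis mult.assoc mult_1)
    have Rey: "Re y = - 1 / 2" using i by (simp add: y_def inner_complex_def)
    have "norm y = 1" using uvw by (simp add: y_def norm_mult)
    then have "(Im y)\<^sup>2 = 3 / 4" using Rey by (simp add: norm_1_iff power2_eq_square)
    then have "(Im y)\<^sup>2 = (sqrt 3 / 2)\<^sup>2" by (simp add: power_divide)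
    then have "Im y = sqrt 3 / 2 \<or> Im y = - sqrt 3 / 2" by (auto simp: power2_eq_iff)
    moreover have "Im y < 0"
    proof -
      have "cnj (v - u) * (w - u) = u * cnj u * ((cnj y - 1) * (- 2 - y))"
        unfolding w unfolding v by (simp add: algebra_simps)
      then have "Im (cnj (v - u) * (w - u)) = Im ((cnj y - 1) * (- 2 - y))"
        using uu by (metis mult_1)
      also have "\<dots> = 3 * Im y" by (simp add: algebra_simps)
      finally have "Im (cnj (v - u) * (w - u)) = 3 * Im y" .
      moreover have "Im (cnj (v - u) * (w - u)) < 0"
        using \<open>?L\<close> ab unfolding clockwise_def P Q R cross by (simp add: mult_less_0_iff)
      ultimately show ?thesis by simp
    qed
    moreover have "sqrt 3 > (0::real)" by simp
    ultimately have "Im y = - sqrt 3 / 2" by argo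
    then have "y = cnj \<zeta>" by (simp add: complex_eq_iff Rey Re_zeta Im_zeta)
    moreover have "w = u * \<zeta>"
    proof -
      have "- 1 - cnj \<zeta> = \<zeta>" by (simp add: complex_eq_iff Re_zeta Im_zeta)
      then show ?thesis unfolding w v \<open>y = cnj \<zeta>\<close> by (metis mult.right_neutral mult_minus_right right_diff_distrib)
    qed
    ultimately show ?R using uvw P Q R v by blast
  next
    assume ?R
    then obtain u where u: "norm u = 1" and P: "P = stretch a b u" and Q: "Q = stretch a b (u * cnj \<zeta>)"
      and R: "R = stretch a b (u * \<zeta>)" by blast
    have nz: "norm \<zeta> = 1" by (simp add: \<zeta>_def)
    have uu: "(Re u)\<^sup>2 + (Im u)\<^sup>2 = 1" using u by (simp add: norm_1_iff)
    have "Im (cnj (u * cnj \<zeta> - u) * (u * \<zeta> - u)) = Im ((norm u)\<^sup>2 * ((\<zeta> - 1) * (\<zeta> - 1)))"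
      unfolding complex_norm_square by (simp add: algebra_simps)
    also have "\<dots> = - 3 * sqrt 3 / 2" using u by (simp add: Re_zeta Im_zeta)
    finally have "Im (cnj (u * cnj \<zeta> - u) * (u * \<zeta> - u)) < 0" by simp
    then have cl: "clockwise P Q R"
      unfolding clockwise_def P Q R cross using ab by (simp add: mult_less_0_iff)
    moreover have "\<not> collinear {P, Q, R}" using cl collinear_imp_cross_eq_0[of P Q R] by (auto simp: clockwise_def)
    moreover have "{P, Q, R} \<subseteq> ellipse a b"
      unfolding P Q R ellipse_eq_stretch[OF ab] using u nz by (auto simp: norm_mult)
    moreover have "u \<bullet> (u * cnj \<zeta>) = - 1 / 2 * ((Re u)\<^sup>2 + (Im u)\<^sup>2)"
      "(u * cnj \<zeta>) \<bullet> (u * \<zeta>) = - 1 / 2 * ((Re u)\<^sup>2 + (Im u)\<^sup>2)"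
      "(u * \<zeta>) \<bullet> u = - 1 / 2 * ((Re u)\<^sup>2 + (Im u)\<^sup>2)"
      by (simp_all add: inner_complex_def Re_zeta Im_zeta power2_eq_square algebra_simps)
    ultimately show ?L
      unfolding homothetic_pair_triangle_def inscribed_triangle_def circumscribed_triangle_def
      using uu u nz unfolding P Q R by (auto simp: side_tangent_stretch_iff[OF ab] norm_mult)
  }
qed

section \<open>Barycentric coordinates of the first Brocard point\<close>

text \<open>
  The unoriented angle at a vertex is the arc cotangent of the quotient of inner product and cross
  product, provided the orientation is the expected one. In this form equality of angles becomes a
  rational condition.
\<close>

lemma angle_at_eq_arctan:
  assumes "Im (cnj (X - P) * (Q - P)) > 0"
  shows "angle_at X P Q = pi / 2 - arctan (Re (cnj (X - P) * (Q - P)) / Im (cnj (X - P) * (Q - P)))"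
proof -
  define z where "z = cnj (X - P) * (Q - P)"
  define k where "k = Re z / Im z"
  have pos: "Im z > 0" using assms by (simp add: z_def)
  have "norm z = sqrt ((Im z)\<^sup>2 * (1 + k\<^sup>2))"
    using pos by (simp add: cmod_def k_def power_divide field_simps)
  then have n: "norm z = Im z * sqrt (1 + k\<^sup>2)" using pos by (simp add: real_sqrt_mult)
  have "(X - P) \<bullet> (Q - P) = Re z" "norm (X - P) * norm (Q - P) = norm z"
    by (simp_all only: z_def norm_mult complex_mod_cnj) (simp add: inner_complex_def algebra_simps)
  then have "angle_at X P Q = arccos (Re z / norm z)"
    by (simp add: angle_at_def)
  also have "Re z / norm z = sin (arctan k)"
    using pos by (simp add: n sin_arctan k_def)
  also have "arccos \<dots> = arccos (cos (pi / 2 - arctan k))" by (simp add: cos_diff)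
  also have "\<dots> = pi / 2 - arctan k"
    using arctan_bounded[of k] by (intro arccos_cos) auto
  finally show ?thesis by (simp add: z_def k_def)
qed

text \<open>
  The cross products at the three vertices are \<open>\<gamma> D\<close>, \<open>\<alpha> D\<close>, \<open>\<beta> D\<close>, where \<open>D\<close> is twice the area,
  and the inner products are \<open>\<gamma> S\<close>, \<open>\<alpha> S\<close>, \<open>\<beta> S\<close>, where \<open>S\<close> is half the sum of the squared
  sides, plus three corrections with sum zero. Equal cotangents force the corrections to be
  proportional to \<open>\<gamma>\<close>, \<open>\<alpha>\<close>, \<open>\<beta>\<close>, hence to vanish. The common cotangent is \<open>S / D\<close>.
\<close>

lemma brocard_1_angles_iff:
  fixes P Q R X :: complex and \<alpha> \<beta> \<gamma> :: real
  assumes cl: "clockwise P Q R"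
    and pos: "\<alpha> > 0" "\<beta> > 0" "\<gamma> > 0" and sum: "\<alpha> + \<beta> + \<gamma> = 1"
    and X: "X = \<alpha> *\<^sub>R P + \<beta> *\<^sub>R Q + \<gamma> *\<^sub>R R"
  shows "(\<exists>\<omega>. angle_at X P Q = \<omega> \<and> angle_at X Q R = \<omega> \<and> angle_at X R P = \<omega>) \<longleftrightarrow>
     \<alpha> * (norm (P - R))\<^sup>2 = \<beta> * (norm (Q - P))\<^sup>2 \<and> \<beta> * (norm (Q - P))\<^sup>2 = \<gamma> * (norm (R - Q))\<^sup>2"
proof -
  define D where "D = - Im (cnj (Q - P) * (R - P))"
  have D: "D > 0" using cl by (simp add: clockwise_def D_def)
  define E where "E = (norm (Q - P))\<^sup>2"
  define F where "F = (norm (P - R))\<^sup>2"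
  define H where "H = (norm (R - Q))\<^sup>2"
  have al: "\<alpha> = 1 - \<beta> - \<gamma>" using sum by simp
  have c1: "Im (cnj (X - P) * (Q - P)) = \<gamma> * D"
    and c2: "Im (cnj (X - Q) * (R - Q)) = \<alpha> * D"
    and c3: "Im (cnj (X - R) * (P - R)) = \<beta> * D"
    unfolding X D_def al by (simp_all add: algebra_simps)
  define S where "S = (E + F + H) / 2"
  have d1: "Re (cnj (X - P) * (Q - P)) = \<gamma> * S + (\<beta> * E - \<gamma> * H)"
    and d2: "Re (cnj (X - Q) * (R - Q)) = \<alpha> * S + (\<gamma> * H - \<alpha> * F)"
    and d3: "Re (cnj (X - R) * (P - R)) = \<beta> * S + (\<alpha> * F - \<beta> * E)"
    unfolding X S_def E_def F_def H_def al cmod_power2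
    by (simp_all add: field_simps power2_eq_square)
  have "(\<exists>\<omega>. angle_at X P Q = \<omega> \<and> angle_at X Q R = \<omega> \<and> angle_at X R P = \<omega>) \<longleftrightarrow>
     (\<gamma> * S + (\<beta> * E - \<gamma> * H)) / (\<gamma> * D) = (\<alpha> * S + (\<gamma> * H - \<alpha> * F)) / (\<alpha> * D) \<and>
     (\<alpha> * S + (\<gamma> * H - \<alpha> * F)) / (\<alpha> * D) = (\<beta> * S + (\<alpha> * F - \<beta> * E)) / (\<beta> * D)"
  proof -
    have "angle_at X P Q = pi / 2 - arctan ((\<gamma> * S + (\<beta> * E - \<gamma> * H)) / (\<gamma> * D))"
      "angle_at X Q R = pi / 2 - arctan ((\<alpha> * S + (\<gamma> * H - \<alpha> * F)) / (\<alpha> * D))"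
      "angle_at X R P = pi / 2 - arctan ((\<beta> * S + (\<alpha> * F - \<beta> * E)) / (\<beta> * D))"
      using angle_at_eq_arctan[of X P Q] angle_at_eq_arctan[of X Q R] angle_at_eq_arctan[of X R P] pos D
      unfolding c1 c2 c3 d1 d2 d3 by (simp_all del: arctan_eq_iff)
    then show ?thesis by (auto simp: arctan_eq_iff)
  qed
  also have "\<dots> \<longleftrightarrow> (\<beta> * E - \<gamma> * H) / \<gamma> = (\<gamma> * H - \<alpha> * F) / \<alpha> \<and>
      (\<gamma> * H - \<alpha> * F) / \<alpha> = (\<alpha> * F - \<beta> * E) / \<beta>"
  proof -
    have "(g * S + x) / (g * D) = (g' * S + x') / (g' * D) \<longleftrightarrow> x / g = x' / g'"
      if "g > 0" "g' > 0" for g g' x x'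
    proof -
      have "(g * S + x) / (g * D) = (S + x / g) / D" "(g' * S + x') / (g' * D) = (S + x' / g') / D"
        using that D by (simp_all add: field_simps)
      then show ?thesis using D by simp
    qed
    then show ?thesis using pos by presburger
  qed
  also have "\<dots> \<longleftrightarrow> \<alpha> * F = \<beta> * E \<and> \<beta> * E = \<gamma> * H"
  proof
    assume *: "(\<beta> * E - \<gamma> * H) / \<gamma> = (\<gamma> * H - \<alpha> * F) / \<alpha> \<and>
      (\<gamma> * H - \<alpha> * F) / \<alpha> = (\<alpha> * F - \<beta> * E) / \<beta>"
    define k where "k = (\<beta> * E - \<gamma> * H) / \<gamma>"
    have "(\<beta> * E - \<gamma> * H) / \<gamma> = k" "(\<gamma> * H - \<alpha> * F) / \<alpha> = k" "(\<alpha> * F - \<beta> * E) / \<beta> = k"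
      using * by (simp_all add: k_def)
    then have k: "\<beta> * E - \<gamma> * H = k * \<gamma>" "\<gamma> * H - \<alpha> * F = k * \<alpha>" "\<alpha> * F - \<beta> * E = k * \<beta>"
      using pos by (simp_all add: divide_eq_eq)
    then have "k * (\<alpha> + \<beta> + \<gamma>) = 0" by (simp add: algebra_simps)
    then have "k = 0" using sum by simp
    with k show "\<alpha> * F = \<beta> * E \<and> \<beta> * E = \<gamma> * H" by simp
  qed auto
  finally show ?thesis by (simp add: E_def F_def H_def)
qed

text \<open>
  The equations of the preceding lemma make the barycentric coordinates inversely proportional to the
  squared sides; clearing denominators gives products of two squared sides.
\<close>

lemma brocard_point_1_iff:
  fixes P Q R X :: complex
  assumes cl: "clockwise P Q R"
  defines "E \<equiv> (norm (Q - P))\<^sup>2" and "F \<equiv> (norm (P - R))\<^sup>2" and "H \<equiv> (norm (R - Q))\<^sup>2"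
  shows "brocard_point_1 P Q R X \<longleftrightarrow>
    (E * H + F * H + E * F) *\<^sub>R X = (E * H) *\<^sub>R P + (F * H) *\<^sub>R Q + (E * F) *\<^sub>R R"
proof -
  have nc: "\<not> collinear {P, Q, R}" using cl collinear_imp_cross_eq_0[of P Q R] by (auto simp: clockwise_def)
  then have "P \<noteq> Q" "Q \<noteq> R" "P \<noteq> R" by (auto simp: insert_commute)
  then have pos: "E > 0" "F > 0" "H > 0" by (auto simp: E_def F_def H_def)
  define N where "N = E * H + F * H + E * F"
  have N: "N > 0" using pos by (simp add: N_def add_pos_pos)
  have "brocard_point_1 P Q R X \<longleftrightarrow> (\<exists>\<alpha> \<beta> \<gamma>. \<alpha> > 0 \<and> \<beta> > 0 \<and> \<gamma> > 0 \<and> \<alpha> + \<beta> + \<gamma> = 1 \<and>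
     X = \<alpha> *\<^sub>R P + \<beta> *\<^sub>R Q + \<gamma> *\<^sub>R R \<and> \<alpha> * F = \<beta> * E \<and> \<beta> * E = \<gamma> * H)"
    unfolding brocard_point_1_def interior_convex_hull_3_minimal[OF nc DIM_complex]
    using brocard_1_angles_iff[OF cl, of _ _ _ X] unfolding E_def F_def H_def by blast
  also have "\<dots> \<longleftrightarrow> X = (E * H / N) *\<^sub>R P + (F * H / N) *\<^sub>R Q + (E * F / N) *\<^sub>R R" (is "?l \<longleftrightarrow> ?r")
  proof
    assume ?l
    then obtain \<alpha> \<beta> \<gamma> where s: "\<alpha> + \<beta> + \<gamma> = 1" and
       X: "X = \<alpha> *\<^sub>R P + \<beta> *\<^sub>R Q + \<gamma> *\<^sub>R R" and eq: "\<alpha> * F = \<beta> * E" "\<beta> * E = \<gamma> * H" by blast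
    have "\<alpha> * N = E * H" "\<beta> * N = F * H" "\<gamma> * N = E * F"
      using s eq unfolding N_def by algebra+
    then have "\<alpha> = E * H / N" "\<beta> = F * H / N" "\<gamma> = E * F / N" using N by (simp_all add: eq_divide_eq)
    then show ?r using X by simp
  next
    assume ?r
    moreover have "E * H / N + F * H / N + E * F / N = 1"
      using N by (simp add: N_def flip: add_divide_distrib)
    ultimately show ?l
      using pos N
      by - (rule exI[of _ "E * H / N"], rule exI[of _ "F * H / N"], rule exI[of _ "E * F / N"], simp add: mult_ac)
  qed
  also have "\<dots> \<longleftrightarrow> N *\<^sub>R X = (E * H) *\<^sub>R P + (F * H) *\<^sub>R Q + (E * F) *\<^sub>R R"
  proof -
    have "(E * H / N) *\<^sub>R P + (F * H / N) *\<^sub>R Q + (E * F / N) *\<^sub>R R =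
        inverse N *\<^sub>R ((E * H) *\<^sub>R P + (F * H) *\<^sub>R Q + (E * F) *\<^sub>R R)"
      by (simp add: scaleR_right_distrib divide_inverse mult.commute)
    then show ?thesis using N by (metis less_irrefl real_vector.scale_left_imp_eq scaleR_scaleR right_inverse left_inverse scaleR_one)
  qed
  finally show ?thesis by (simp add: N_def)
qed

lemma zeta_cube_root: "\<zeta>\<^sup>2 + \<zeta> + 1 = 0" "cnj \<zeta> = \<zeta>\<^sup>2"
  by (simp_all add: complex_eq_iff Re_zeta Im_zeta power2_eq_square)

section \<open>The locus of the first Brocard point\<close>

text \<open>
  One third of the squared sides are \<open>E\<close>, \<open>F\<close>, \<open>H\<close>, with \<open>v\<close> for \<open>cnj u\<close> and \<open>m\<close> for \<open>p q\<close>. The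
  substitution of \<open>u z\<close> for \<open>u\<close> and \<open>v z\<^sup>2\<close> for \<open>v\<close> permutes them cyclically and multiplies the
  three sums by \<open>z\<^sup>2\<close>, \<open>z\<close> and 1. It multiplies a monomial \<open>u^i v^j\<close> by \<open>z^(i - j)\<close>, so only the
  monomials with the matching residue of \<open>i - j\<close> modulo 3 survive. The first two sums are the
  coefficients of \<open>p u\<close> and \<open>q v\<close> in the weighted sum of the vertices, the third is the total weight.
\<close>

lemma brocard_weights_identity:
  fixes s m u v z :: complex
  assumes z: "z\<^sup>2 + z + 1 = 0"
  defines "H \<equiv> s - m * (u\<^sup>2 + v\<^sup>2)"
    and "E \<equiv> s - m * (u\<^sup>2 * z\<^sup>2 + v\<^sup>2 * z)"
    and "F \<equiv> s - m * (u\<^sup>2 * z + v\<^sup>2 * z\<^sup>2)"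
  shows "E * H + F * H * z\<^sup>2 + E * F * z = 3 * m * z * (s * u\<^sup>2 + m * v^4)"
    and "E * H + F * H * z + E * F * z\<^sup>2 = 3 * m * z\<^sup>2 * (s * v\<^sup>2 + m * u^4)"
    and "E * H + F * H + E * F = 3 * (s\<^sup>2 - m\<^sup>2 * (u * v)\<^sup>2)"
  using z unfolding H_def E_def F_def by algebra+

lemma brocard_barycentric_identity:
  fixes p q u v z :: complex
  assumes uv: "u * v = 1" and z: "z\<^sup>2 + z + 1 = 0"
  defines "s \<equiv> p\<^sup>2 + q\<^sup>2"
  defines "H \<equiv> s - p * q * (u\<^sup>2 + v\<^sup>2)"
    and "E \<equiv> s - p * q * (u\<^sup>2 * z\<^sup>2 + v\<^sup>2 * z)"
    and "F \<equiv> s - p * q * (u\<^sup>2 * z + v\<^sup>2 * z\<^sup>2)"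
  shows "E * H * (p * u + q * v) + F * H * (p * u * z\<^sup>2 + q * v * z) + E * F * (p * u * z + q * v * z\<^sup>2)
       = 3 * (p * q) * (p * (p\<^sup>2 * z - q\<^sup>2) * u^3 + q * (q\<^sup>2 * z\<^sup>2 - p\<^sup>2) * v^3)"
    and "E * H + F * H + E * F = 3 * (p^4 + p\<^sup>2 * q\<^sup>2 + q^4)"
proof -
  note C = brocard_weights_identity[OF z, of s "p * q" u v, folded H_def E_def F_def]
  have v: "u * v^4 = v^3" "v * u^4 = u^3" using uv by algebra+
  have "E * H * (p * u + q * v) + F * H * (p * u * z\<^sup>2 + q * v * z) + E * F * (p * u * z + q * v * z\<^sup>2)
      = p * u * (E * H + F * H * z\<^sup>2 + E * F * z) + q * v * (E * H + F * H * z + E * F * z\<^sup>2)"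
    by (simp add: algebra_simps)
  also have "\<dots> = 3 * (p * q) * (p * z * (s * u^3 + p * q * (u * v^4)) + q * z\<^sup>2 * (s * v^3 + p * q * (v * u^4)))"
    unfolding C(1,2) by algebra
  also have "\<dots> = 3 * (p * q) * (p * (p\<^sup>2 * z - q\<^sup>2) * u^3 + q * (q\<^sup>2 * z\<^sup>2 - p\<^sup>2) * v^3)"
    unfolding v s_def using z by algebra
  finally show "E * H * (p * u + q * v) + F * H * (p * u * z\<^sup>2 + q * v * z) + E * F * (p * u * z + q * v * z\<^sup>2)
       = 3 * (p * q) * (p * (p\<^sup>2 * z - q\<^sup>2) * u^3 + q * (q\<^sup>2 * z\<^sup>2 - p\<^sup>2) * v^3)" .
  show "E * H + F * H + E * F = 3 * (p^4 + p\<^sup>2 * q\<^sup>2 + q^4)"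
    unfolding C(3) uv s_def by (simp add: algebra_simps power2_eq_square power4_eq_xxxx)
qed

text \<open>
  The side opposite to the vertex \<open>w\<close>: the chord \<open>x - y\<close> is \<open>w\<close> turned by a right angle and
  multiplied by \<open>sqrt 3\<close>, and the turn changes the sign of the mixed term.
\<close>

lemma side_length_stretch:
  fixes a b :: real
  defines "p \<equiv> complex_of_real ((a + b) / 2)" and "q \<equiv> complex_of_real ((a - b) / 2)"
  assumes "norm x = 1" "norm y = 1" "norm w = 1" and sum: "x + y + w = 0"
  shows "complex_of_real ((norm (stretch a b x - stretch a b y))\<^sup>2) =
    3 * (p\<^sup>2 + q\<^sup>2 - p * q * (w\<^sup>2 + (cnj w)\<^sup>2))"
proof -
  have unit: "x * cnj x = 1" "y * cnj y = 1" "w * cnj w = 1"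
    using assms by (simp_all add: complex_norm_square[symmetric])
  have square: "(x' - y')\<^sup>2 = - 3 * w'\<^sup>2"
    if "x' * x'' = 1" "y' * y'' = 1" "w' * w'' = 1" "x' + y' + w' = 0" "x'' + y'' + w'' = 0"
    for x' x'' y' y'' w' w'' :: complex
  proof -
    have "w'' * (x' * y') = - (x' + y')" using that(1,2,5) by algebra
    then have "w'\<^sup>2 = x' * y'" using that(3,4) by algebra
    moreover have "w' = - (x' + y')" using that(4) by algebra
    ultimately show ?thesis by algebra
  qed
  have sum': "cnj x + cnj y + cnj w = 0" using sum by (metis complex_cnj_add complex_cnj_zero)
  have d: "(x - y)\<^sup>2 = - 3 * w\<^sup>2" "(cnj x - cnj y)\<^sup>2 = - 3 * (cnj w)\<^sup>2"
    using square[OF unit sum sum'] square[of "cnj x" x "cnj y" y "cnj w" w] unit sum sum'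
    by (simp_all add: mult.commute)
  have "(x - y) * (cnj x - cnj y) = 2 * (x * cnj x) + 2 * (y * cnj y) - (x + y) * (cnj x + cnj y)"
    by (simp add: algebra_simps)
  also have "(x + y) * (cnj x + cnj y) = (- w) * (- cnj w)"
    using sum sum' by (metis add_eq_0_iff2)
  finally have dd: "(x - y) * (cnj x - cnj y) = 3" using unit by simp
  have "cnj p = p" "cnj q = q" by (simp_all add: p_def q_def)
  then have "complex_of_real ((norm (stretch a b x - stretch a b y))\<^sup>2) =
    (p * x + q * cnj x - (p * y + q * cnj y)) * (p * cnj x + q * x - (p * cnj y + q * y))"
    unfolding complex_norm_square stretch_eq p_def[symmetric] q_def[symmetric] by simp
  also have "\<dots> = (p\<^sup>2 + q\<^sup>2) * ((x - y) * (cnj x - cnj y)) + p * q * ((x - y)\<^sup>2 + (cnj x - cnj y)\<^sup>2)"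
    by (simp add: algebra_simps power2_eq_square)
  also have "\<dots> = 3 * (p\<^sup>2 + q\<^sup>2 - p * q * (w\<^sup>2 + (cnj w)\<^sup>2))"
    unfolding d dd by (simp add: algebra_simps)
  finally show ?thesis .
qed

lemma brocard_point_1_family_iff:
  fixes a b :: real
  assumes ab: "a > 0" "b > 0" and u: "norm u = 1"
  defines "p \<equiv> complex_of_real ((a + b) / 2)" and "q \<equiv> complex_of_real ((a - b) / 2)"
  shows "brocard_point_1 (stretch a b u) (stretch a b (u * cnj \<zeta>)) (stretch a b (u * \<zeta>)) X \<longleftrightarrow>
    (p^4 + p\<^sup>2 * q\<^sup>2 + q^4) * X =
      p * q * (p * (p\<^sup>2 * \<zeta> - q\<^sup>2) * u^3 + q * (q\<^sup>2 * \<zeta>\<^sup>2 - p\<^sup>2) * (cnj u)^3)"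
proof -
  let ?P = "stretch a b u" and ?Q = "stretch a b (u * cnj \<zeta>)" and ?R = "stretch a b (u * \<zeta>)"
  define v where "v = cnj u"
  define s where "s = p\<^sup>2 + q\<^sup>2"
  have uv: "u * v = 1" using u by (simp add: v_def complex_norm_square[symmetric])
  have z: "\<zeta>\<^sup>2 + \<zeta> + 1 = 0" "cnj \<zeta> = \<zeta>\<^sup>2" by (rule zeta_cube_root)+
  have cz: "cnj (\<zeta>\<^sup>2) = \<zeta>" using z(2) by (metis complex_cnj_cnj)
  have z3: "\<zeta>^4 = \<zeta>" using z(1) by algebra
  have nz: "norm \<zeta> = 1" "norm (\<zeta>\<^sup>2) = 1" by (simp_all add: \<zeta>_def norm_power)
  have sum: "u * cnj \<zeta> + u + u * \<zeta> = 0" unfolding z(2) using z(1) by algebra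
  define H where "H = s - p * q * (u\<^sup>2 + v\<^sup>2)"
  define E where "E = s - p * q * (u\<^sup>2 * \<zeta>\<^sup>2 + v\<^sup>2 * \<zeta>)"
  define F where "F = s - p * q * (u\<^sup>2 * \<zeta> + v\<^sup>2 * \<zeta>\<^sup>2)"
  have E: "complex_of_real ((norm (?Q - ?P))\<^sup>2) = 3 * E"
    using side_length_stretch[of "u * cnj \<zeta>" u "u * \<zeta>" a b] u nz sum
    by (simp add: norm_mult E_def s_def v_def p_def q_def power_mult_distrib z z3 flip: power_mult)
  have F: "complex_of_real ((norm (?P - ?R))\<^sup>2) = 3 * F"
    using side_length_stretch[of u "u * \<zeta>" "u * cnj \<zeta>" a b] u nz sum
    by (simp add: norm_mult F_def s_def v_def p_def q_def power_mult_distrib z z3 cz add_ac flip: power_mult)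
  have H: "complex_of_real ((norm (?R - ?Q))\<^sup>2) = 3 * H"
    using side_length_stretch[of "u * \<zeta>" "u * cnj \<zeta>" u a b] u nz sum
    by (simp add: norm_mult H_def s_def v_def p_def q_def add_ac)
  have P: "?P = p * u + q * v" and Q: "?Q = p * u * \<zeta>\<^sup>2 + q * v * \<zeta>" and R: "?R = p * u * \<zeta> + q * v * \<zeta>\<^sup>2"
    unfolding stretch_eq p_def[symmetric] q_def[symmetric] v_def by (simp_all add: z z3 flip: power_mult)
  have cl: "clockwise ?P ?Q ?R" using homothetic_pair_triangle_iff[OF ab] u by blast
  have "brocard_point_1 ?P ?Q ?R X \<longleftrightarrow>
    (3 * E * (3 * H) + 3 * F * (3 * H) + 3 * E * (3 * F)) * X =
    3 * E * (3 * H) * ?P + 3 * F * (3 * H) * ?Q + 3 * E * (3 * F) * ?R"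
    unfolding brocard_point_1_iff[OF cl] scaleR_conv_of_real of_real_add of_real_mult E F H ..
  also have "\<dots> \<longleftrightarrow> 9 * ((E * H + F * H + E * F) * X) = 9 * (E * H * ?P + F * H * ?Q + E * F * ?R)"
    by (simp add: algebra_simps)
  also have "\<dots> \<longleftrightarrow> (E * H + F * H + E * F) * X = E * H * ?P + F * H * ?Q + E * F * ?R"
    by (simp only: mult_cancel_left) simp
  also have "\<dots> \<longleftrightarrow> 3 * ((p^4 + p\<^sup>2 * q\<^sup>2 + q^4) * X) =
     3 * (p * q * (p * (p\<^sup>2 * \<zeta> - q\<^sup>2) * u^3 + q * (q\<^sup>2 * \<zeta>\<^sup>2 - p\<^sup>2) * v^3))"
    using brocard_barycentric_identity[OF uv z(1), of p q]
    unfolding P Q R E_def F_def H_def s_def by (simp only: mult.assoc)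
  finally show ?thesis by (simp add: v_def)
qed

lemma unit_cube_root_exists:
  fixes y :: complex
  assumes "norm y = 1"
  shows "\<exists>u. norm u = 1 \<and> u ^ 3 = y"
proof (intro exI conjI)
  show "norm (cis (Arg y / 3)) = 1" by simp
  have "y \<noteq> 0" using assms by auto
  then have "cis (Arg y) = y" using assms by (simp add: cis_Arg sgn_eq)
  then show "cis (Arg y / 3) ^ 3 = y" by (simp add: Complex.DeMoivre)
qed

text \<open>
  Two independent rotations of the two circular components amount to one rotation of the ellipse by
  \<open>c\<close> and a shift of the parameter; \<open>c\<close> is a square root of the product of the two.
\<close>

lemma ellipse_reparametrisation:
  fixes a b :: real and A B :: complex
  assumes A: "norm A = 1" and B: "norm B = 1"
  obtains c where "norm c = 1" "(\<lambda>y. of_real ((a + b) / 2) * A * y + of_real ((a - b) / 2) * B * cnj y) ` sphere 0 1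
    = (\<lambda>z. c * z) ` stretch a b ` sphere 0 1"
proof
  define c where "c = csqrt (A * B)"
  show c: "norm c = 1" using A B by (simp add: c_def norm_mult)
  have cc: "c * cnj c = 1" "A * cnj A = 1" "c * c = A * B" using A c
    by (simp_all add: complex_norm_square[symmetric]) (simp add: c_def flip: power2_eq_square)
  have eq: "of_real ((a + b) / 2) * A * y + of_real ((a - b) / 2) * B * cnj y = c * stretch a b (A * cnj c * y)" for y
  proof -
    have "c * (A * cnj c * y) = A * y" "c * (cnj A * c * cnj y) = B * cnj y"
      using cc by algebra+
    then show ?thesis unfolding stretch_eq complex_cnj_mult complex_cnj_cnj distrib_left
      by (simp only: mult.left_commute[of c]) (simp only: mult_ac)
  qed
  have "(\<lambda>y. A * cnj c * y) ` sphere 0 1 = sphere 0 1"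
  proof
    show "(\<lambda>y. A * cnj c * y) ` sphere 0 1 \<subseteq> sphere 0 1" using A c by (auto simp: norm_mult)
    show "sphere 0 1 \<subseteq> (\<lambda>y. A * cnj c * y) ` sphere 0 1"
    proof
      fix w :: complex assume "w \<in> sphere 0 1"
      then have "cnj A * c * w \<in> sphere 0 1" using A c by (simp add: norm_mult)
      moreover have "w = A * cnj c * (cnj A * c * w)" using cc by algebra
      ultimately show "w \<in> (\<lambda>y. A * cnj c * y) ` sphere 0 1" by blast
    qed
  qed
  then show "(\<lambda>y. of_real ((a + b) / 2) * A * y + of_real ((a - b) / 2) * B * cnj y) ` sphere 0 1
    = (\<lambda>z. c * z) ` stretch a b ` sphere 0 1"
    unfolding eq image_image[of "\<lambda>z. c * stretch a b z" "\<lambda>y. A * cnj c * y", symmetric] by (simp add: image_image)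
qed

lemma mem_brocard_locus_1_iff:
  fixes a b :: real
  assumes ab: "a > 0" "b > 0"
  defines "p \<equiv> complex_of_real ((a + b) / 2)" and "q \<equiv> complex_of_real ((a - b) / 2)"
  shows "X \<in> brocard_locus_1 a b \<longleftrightarrow> (\<exists>y \<in> sphere 0 1. (p^4 + p\<^sup>2 * q\<^sup>2 + q^4) * X =
      p * q * (p * (p\<^sup>2 * \<zeta> - q\<^sup>2) * y + q * (q\<^sup>2 * \<zeta>\<^sup>2 - p\<^sup>2) * cnj y))" (is "_ \<longleftrightarrow> (\<exists>y \<in> _. ?\<phi> y)")
proof -
  have "X \<in> brocard_locus_1 a b \<longleftrightarrow> (\<exists>P Q R. (homothetic_pair_triangle a b P Q R \<and> clockwise P Q R) \<and> brocard_point_1 P Q R X)"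
    by (simp add: brocard_locus_1_def)
  also have "\<dots> \<longleftrightarrow> (\<exists>u. norm u = 1 \<and>
      brocard_point_1 (stretch a b u) (stretch a b (u * cnj \<zeta>)) (stretch a b (u * \<zeta>)) X)"
    unfolding homothetic_pair_triangle_iff[OF ab] by blast
  also have "\<dots> \<longleftrightarrow> (\<exists>u. norm u = 1 \<and> ?\<phi> (u^3))"
    using brocard_point_1_family_iff[OF ab] unfolding p_def q_def complex_cnj_power by blast
  also have "\<dots> \<longleftrightarrow> (\<exists>y \<in> sphere 0 1. ?\<phi> y)"
  proof
    assume "\<exists>u. norm u = 1 \<and> ?\<phi> (u^3)"
    then obtain u where "norm u = 1" "?\<phi> (u^3)" by blast
    then show "\<exists>y \<in> sphere 0 1. ?\<phi> y" by (intro bexI[of _ "u^3"]) (simp_all add: norm_power)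
  next
    assume "\<exists>y \<in> sphere 0 1. ?\<phi> y"
    then obtain y where "norm y = 1" "?\<phi> y" by auto
    then show "\<exists>u. norm u = 1 \<and> ?\<phi> (u^3)" using unit_cube_root_exists[of y] by blast
  qed
  finally show ?thesis .
qed

text \<open>
  Because the real part of \<open>\<zeta>\<close> is -1/2, the factors \<open>p\<^sup>2 \<zeta> - q\<^sup>2\<close> and \<open>q\<^sup>2 \<zeta>\<^sup>2 - p\<^sup>2\<close> have the same modulus
  \<open>sqrt N\<close>, so that both components are scaled alike. The number \<open>p q / sqrt N\<close> has the sign of
  \<open>a - b\<close>; a negative sign goes into the rotation.
\<close>

lemma brocard_locus_1_eq:
  assumes ab: "a > 0" "b > 0" "a \<noteq> b"
  obtains c k where "norm c = 1" "k > 0" "brocard_locus_1 a b = (\<lambda>z. c * (of_real k * z)) ` ellipse a b"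
proof -
  define p where "p = (a + b) / 2"
  define q where "q = (a - b) / 2"
  define N where "N = p^4 + p\<^sup>2 * q\<^sup>2 + q^4"
  have pq: "p \<noteq> 0" "q \<noteq> 0" using ab by (auto simp: p_def q_def)
  then have N: "N > 0" by (simp add: N_def add_pos_pos)
  define A where "A = (complex_of_real (p\<^sup>2) * \<zeta> - of_real (q\<^sup>2)) / of_real (sqrt N)"
  define B where "B = (complex_of_real (q\<^sup>2) * \<zeta>\<^sup>2 - of_real (p\<^sup>2)) / of_real (sqrt N)"
  have nA: "norm A = 1" and nB: "norm B = 1"
  proof -
    have "\<zeta>\<^sup>2 = cnj \<zeta>" by (simp add: zeta_cube_root)
    then have "(norm (complex_of_real (p\<^sup>2) * \<zeta> - of_real (q\<^sup>2)))\<^sup>2 = N"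
      "(norm (complex_of_real (q\<^sup>2) * \<zeta>\<^sup>2 - of_real (p\<^sup>2)))\<^sup>2 = N"
      unfolding cmod_power2 N_def
      by (simp_all add: Re_zeta Im_zeta power2_eq_square power4_eq_xxxx field_simps)
    then have "norm (complex_of_real (p\<^sup>2) * \<zeta> - of_real (q\<^sup>2)) = sqrt N"
      "norm (complex_of_real (q\<^sup>2) * \<zeta>\<^sup>2 - of_real (p\<^sup>2)) = sqrt N"
      by (metis norm_ge_zero real_sqrt_unique)+
    then show "norm A = 1" "norm B = 1" using N by (simp_all add: A_def B_def norm_divide)
  qed
  obtain c where c: "norm c = 1" and
    im: "(\<lambda>y. of_real p * A * y + of_real q * B * cnj y) ` sphere 0 1 = (\<lambda>z. c * z) ` stretch a b ` sphere 0 1"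
    using ellipse_reparametrisation[OF nA nB, of a b] unfolding p_def q_def by blast
  define k where "k = p * q / sqrt N"
  have k: "k \<noteq> 0" using pq N by (simp add: k_def)
  have "X \<in> brocard_locus_1 a b \<longleftrightarrow> X \<in> (\<lambda>z. of_real k * z) ` (\<lambda>y. of_real p * A * y + of_real q * B * cnj y) ` sphere 0 1" for X
  proof -
    have "complex_of_real N * X = p * q * (p * (p\<^sup>2 * \<zeta> - q\<^sup>2) * y + q * (q\<^sup>2 * \<zeta>\<^sup>2 - p\<^sup>2) * cnj y) \<longleftrightarrow>
       X = of_real k * (of_real p * A * y + of_real q * B * cnj y)" for y
    proof -
      have r: "complex_of_real N = of_real (sqrt N) * of_real (sqrt N)" "complex_of_real (sqrt N) \<noteq> 0"
        using N by (simp_all flip: of_real_mult)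
      have scale: "r * r * X = k' * (l * x * y + m * z * y') \<longleftrightarrow> X = k' / r * (l * (x / r) * y + m * (z / r) * y')"
        if "r \<noteq> 0" for r k' l m x z y' :: complex
        using that by (auto simp: field_simps)
      show ?thesis unfolding r(1) k_def A_def B_def of_real_divide of_real_mult
        by (rule scale[OF r(2)])
    qed
    then show ?thesis
      using mem_brocard_locus_1_iff[OF ab(1,2), of X]
      unfolding N_def p_def[symmetric] q_def[symmetric] by (auto simp: image_iff)
  qed
  then have "brocard_locus_1 a b = (\<lambda>z. of_real k * z) ` (\<lambda>y. of_real p * A * y + of_real q * B * cnj y) ` sphere 0 1" by blast
  also have "\<dots> = (\<lambda>z. (of_real (sgn k) * c) * (of_real \<bar>k\<bar> * z)) ` ellipse a b"
  proof -
    have "complex_of_real k * (c * z) = (of_real (sgn k) * c) * (of_real \<bar>k\<bar> * z)" for z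
      using mult_sgn_abs[of k] by (metis (no_types, lifting) mult.assoc mult.left_commute of_real_mult)
    then show ?thesis unfolding im ellipse_eq_stretch[OF ab(1,2)] image_image by (simp only:)
  qed
  finally have "brocard_locus_1 a b = (\<lambda>z. (of_real (sgn k) * c) * (of_real \<bar>k\<bar> * z)) ` ellipse a b" .
  moreover have "norm (of_real (sgn k) * c) = 1" "\<bar>k\<bar> > 0"
    using c k by (simp_all add: norm_mult abs_sgn_eq)
  ultimately show thesis by (intro that)
qed

section \<open>Shape and reflections of the loci\<close>

lemma rotated_ellipse:
  assumes ab: "a > 0" "b > 0" and c: "norm c = 1" and k: "k > 0"
    and E: "E = (\<lambda>z. c * (of_real k * z)) ` ellipse a b"
  shows "ellipse_centered_at 0 E"
    and "homothetic_up_to_rotation 0 E (ellipse a b)"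
    and "homothetic_up_to_rotation 0 E (ellipse (a / 2) (b / 2))"
proof -
  obtain t where t: "c = cis t"
    using c cis_Arg[of c] by (metis norm_zero zero_neq_one sgn_eq of_real_1 div_by_1)
  have "E = (\<lambda>z. 0 + cis t * z) ` ellipse (k * a) (k * b)"
    unfolding E t ellipse_scale[OF ab k] image_image by simp
  moreover have "k * a > 0" "k * b > 0" using ab k by simp_all
  ultimately show "ellipse_centered_at 0 E"
    unfolding ellipse_centered_at_def by blast
  have "E = (\<lambda>z. 0 + cis t * (of_real k * (z - 0))) ` ellipse a b"
    unfolding E t by simp
  then show "homothetic_up_to_rotation 0 E (ellipse a b)"
    unfolding homothetic_up_to_rotation_def using k by blast
  have "ellipse a b = (\<lambda>z. of_real 2 * z) ` ellipse (a / 2) (b / 2)"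
    using ellipse_scale[of "a / 2" "b / 2" 2] ab by simp
  then have "E = (\<lambda>z. 0 + cis t * (of_real (2 * k) * (z - 0))) ` ellipse (a / 2) (b / 2)"
    unfolding E t by (simp add: image_image mult_ac)
  moreover have "2 * k > 0" using k by simp
  ultimately show "homothetic_up_to_rotation 0 E (ellipse (a / 2) (b / 2))"
    unfolding homothetic_up_to_rotation_def by blast
qed

text \<open>
  A reflection reverses the orientation, so the images of the second and the third vertex are
  exchanged to keep the labelling clockwise; this turns the angles that define one Brocard point into
  those of the other.
\<close>

context
  fixes h :: "complex \<Rightarrow> complex"
  assumes h: "h = cnj \<or> h = (\<lambda>z. - cnj z)"
begin

lemma reflection_involution: "h (h z) = z"
  using h by auto

lemma angle_at_reflection: "angle_at (h A) (h B) (h C) = angle_at A B C"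
proof -
  have "norm (h x - h y) = norm (x - y)" "(h x - h y) \<bullet> (h z - h y) = (x - y) \<bullet> (z - y)" for x y z
    using h by (auto simp: inner_complex_def cmod_def power2_eq_square algebra_simps)
  then show ?thesis by (simp add: angle_at_def)
qed

lemma brocard_point_reflection:
  "brocard_point_2 P Q R X \<longleftrightarrow> brocard_point_1 (h P) (h R) (h Q) (h X)"
proof -
  have lin: "linear h" using h by (auto intro!: linearI)
  have bij: "bij h" using reflection_involution by (intro involuntory_imp_bij)
  have "h ` {P, Q, R} = {h P, h R, h Q}" by auto
  then have "interior (convex hull {h P, h R, h Q}) = h ` interior (convex hull {P, Q, R})"
    by (metis convex_hull_linear_image[OF lin] interior_bijective_linear_image[OF lin bij])
  then have "h X \<in> interior (convex hull {h P, h R, h Q}) \<longleftrightarrow> X \<in> interior (convex hull {P, Q, R})"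
    using bij by (simp add: bij_is_inj inj_image_mem_iff)
  then show ?thesis
    unfolding brocard_point_1_def brocard_point_2_def angle_at_reflection by auto
qed

lemma homothetic_pair_triangle_reflection:
  assumes ab: "a > 0" "b > 0" and T: "homothetic_pair_triangle a b P Q R \<and> clockwise P Q R"
  shows "homothetic_pair_triangle a b (h P) (h R) (h Q) \<and> clockwise (h P) (h R) (h Q)"
proof -
  obtain u where u: "norm u = 1" "P = stretch a b u" "Q = stretch a b (u * cnj \<zeta>)" "R = stretch a b (u * \<zeta>)"
    using T homothetic_pair_triangle_iff[OF ab] by blast
  have "h (stretch a b x) = stretch a b (h x)" for x
    using h by (auto simp: stretch_def complex_eq_iff)
  moreover have "h (u * \<zeta>) = h u * cnj \<zeta>" "h (u * cnj \<zeta>) = h u * \<zeta>" "norm (h u) = 1"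
    using h u by auto
  ultimately show ?thesis unfolding homothetic_pair_triangle_iff[OF ab] u by auto
qed

lemma brocard_locus_2_eq_reflection:
  assumes ab: "a > 0" "b > 0"
  shows "brocard_locus_2 a b = h ` brocard_locus_1 a b"
proof -
  have 2: "h X \<in> brocard_locus_1 a b" if "X \<in> brocard_locus_2 a b" for X
    using that homothetic_pair_triangle_reflection[OF ab] brocard_point_reflection
    unfolding brocard_locus_1_def brocard_locus_2_def by blast
  have 1: "h X \<in> brocard_locus_2 a b" if X: "X \<in> brocard_locus_1 a b" for X
  proof -
    obtain P Q R where "homothetic_pair_triangle a b P Q R \<and> clockwise P Q R" "brocard_point_1 P Q R X"
      using X unfolding brocard_locus_1_def by blast
    moreover have "brocard_point_2 (h P) (h R) (h Q) (h X) \<longleftrightarrow> brocard_point_1 P Q R X"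
      by (simp add: brocard_point_reflection reflection_involution)
    ultimately show ?thesis using homothetic_pair_triangle_reflection[OF ab] unfolding brocard_locus_2_def by blast
  qed
  show ?thesis
  proof
    show "h ` brocard_locus_1 a b \<subseteq> brocard_locus_2 a b" using 1 by blast
    show "brocard_locus_2 a b \<subseteq> h ` brocard_locus_1 a b"
    proof
      fix X assume "X \<in> brocard_locus_2 a b"
      then have "h (h X) \<in> h ` brocard_locus_1 a b" using 2 by (intro imageI)
      then show "X \<in> h ` brocard_locus_1 a b" by (simp only: reflection_involution)
    qed
  qed
qed

end

lemma cnj_image_ellipse: "cnj ` ellipse a b = ellipse a b"
proof -
  have "cnj z \<in> ellipse a b \<longleftrightarrow> z \<in> ellipse a b" for z by (simp add: ellipse_def ellipse_form_def)
  then have "cnj ` ellipse a b \<subseteq> ellipse a b" "cnj ` cnj ` ellipse a b \<subseteq> cnj ` ellipse a b" by blast+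
  then show ?thesis by (simp add: image_image)
qed

theorem proposition5:
  fixes a b :: real and E\<^sub>1 E\<^sub>2 :: "complex set"
  assumes "a > 0" and "b > 0" and "a \<noteq> b"
    and "E\<^sub>1 = brocard_locus_1 a b" and "E\<^sub>2 = brocard_locus_2 a b"
  shows "ellipse_centered_at 0 E\<^sub>1 \<and> ellipse_centered_at 0 E\<^sub>2 \<and>
    E\<^sub>2 = cnj ` E\<^sub>1 \<and> E\<^sub>2 = (\<lambda>z. - cnj z) ` E\<^sub>1 \<and>
    (\<forall>E \<in> {E\<^sub>1, E\<^sub>2}. \<forall>F \<in> {ellipse a b, ellipse (a / 2) (b / 2)}.
       homothetic_up_to_rotation 0 E F)"
proof -
  note ab = assms(1,2)
  obtain c k where c: "norm c = 1" and k: "k > 0"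
    and E1: "E\<^sub>1 = (\<lambda>z. c * (of_real k * z)) ` ellipse a b"
    using brocard_locus_1_eq[OF assms(1-3)] assms(4) by metis
  have refl: "E\<^sub>2 = cnj ` E\<^sub>1" "E\<^sub>2 = (\<lambda>z. - cnj z) ` E\<^sub>1"
    unfolding assms(4,5) using brocard_locus_2_eq_reflection[OF _ ab] by blast+
  have "E\<^sub>2 = (\<lambda>z. cnj c * (of_real k * z)) ` cnj ` ellipse a b"
    unfolding refl(1) E1 image_image by simp
  then have E2: "E\<^sub>2 = (\<lambda>z. cnj c * (of_real k * z)) ` ellipse a b"
    by (simp only: cnj_image_ellipse)
  have "norm (cnj c) = 1" using c by simp
  note rotated_ellipse[OF ab c k E1] rotated_ellipse[OF ab this k E2]
  with refl show ?thesis by blast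
qed
end
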